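(* Consider a random walk on the triangular lattice satisfying the standing assumptions in the context, with the lattice realized in $\mathbb{R}^2$ along $\mathbf{e}_1=\mathbf{h}_1$, $\mathbf{e}_2=\mathbf{h}_2$. Let $t>0$ and let $\{\delta_n\}_{n=1}^\infty$ be a sequence of positive real numbers with $\lim_{n\to\infty}n\delta_n^2=3t$. Then for every continuous function $f$ on $\mathbb{R}^2$ with compact support and every sequence $\{x_n\}_{n=1}^\infty$ in $V$ with $\lim_{n\to\infty}\delta_nx_n=x\in\mathbb{R}^2$, $$\lim_{n\to\infty}L^n(f\circ\delta_n)(x_n)=H_tf(x).$$
   Context: Triangular lattice: for linearly independent $\mathbf{e}_1,\mathbf{e}_2\in\mathbb{R}^2$ and $\mathbf{e}_3:=\mathbf{e}_2-\mathbf{e}_1$, the graph $G=(V,E)$ has $V=\{x_1\mathbf{e}_1+x_2\mathbf{e}_2:(x_1,x_2)\in\mathbb{Z}^2\}$ and oriented edges $E=\{(x,y)\in V\times V: x-y\in\{\pm\mathbf{e}_1,\pm\mathbf{e}_2,\pm\mathbf{e}_3\}\}$. For an edge $e$, $o(e)$ and $t(e)$ denote its origin and terminus; $E_x=\{e\in E:o(e)=x\}$. Random walk (standing assumptions): $p:E\to[0,\infty)$ satisfies, for every $x\in V$, $p((x,x+\mathbf{e}_1))=\alpha$, $p((x,x-\mathbf{e}_1))=\alpha'$, $p((x,x+\mathbf{e}_2))=\beta'$, $p((x,x-\mathbf{e}_2))=\beta$, $p((x,x+\mathbf{e}_3))=\gamma$, $p((x,x-\mathbf{e}_3))=\gamma'$,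 where $\alpha,\alpha',\beta,\beta',\gamma,\gamma'\ge0$ and $\alpha+\alpha'+\beta+\beta'+\gamma+\gamma'=1$; the zero mean condition $\sum_{e\in E_0}p(e)e=0$ holds (edges starting at the origin identified with vectors); and, with $\widehat\alpha:=\alpha+\alpha'$, $\widehat\beta:=\beta+\beta'$, $\widehat\gamma:=\gamma+\gamma'$, one has $\Gamma(p):=\widehat\alpha\widehat\beta+\widehat\beta\widehat\gamma+\widehat\gamma\widehat\alpha>0$. Standard realization: $l:=\Big(\frac{\widehat\beta+\widehat\gamma}{3\Gamma(p)}\Big)^{1/2}$, $\mathbf{h}_1:={}^t(l,0)$, $\mathbf{h}_2:={}^t\Big(\frac{\widehat\gamma}{\widehat\beta+\widehat\gamma}l,\ \frac{\Gamma(p)^{1/2}}{\widehat\beta+\widehat\gamma}l\Big)$. Transition operator: for $u:V\to\mathbb{R}$, $Lu(x)=\sum_{e\in E_x}p(e)u(t(e))$. For $\delta>0$, $f\circ\delta$ is the function $x\mapsto f(\delta x)$ on $V$. Heat operator: $H_tf(x)=\frac{1}{2\pi t}\int_{\mathbb{R}^2}\exp\Big(-\frac{\|x-z\|_{\mathbb{R}^2}^2}{2t}\Big)f(z)\,dz$. *)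

theory Defs
  imports "HOL-Analysis.Analysis"
begin

definition tri_V :: "real^2 \<Rightarrow> real^2 \<Rightarrow> (real^2) set" where
  "tri_V e1 e2 = {of_int a *\<^sub>R e1 + of_int b *\<^sub>R e2 | a b :: int. True}"

text \<open>The third direction is \<open>e2 - e1\<close>. An oriented edge is a pair (origin, terminus).\<close>

definition tri_E :: "real^2 \<Rightarrow> real^2 \<Rightarrow> ((real^2) \<times> (real^2)) set" where
  "tri_E e1 e2 = {(x, y). x \<in> tri_V e1 e2 \<and> y \<in> tri_V e1 e2 \<and>
     x - y \<in> {e1, - e1, e2, - e2, e2 - e1, - (e2 - e1)}}"

definition tri_E_from :: "real^2 \<Rightarrow> real^2 \<Rightarrow> real^2 \<Rightarrow> ((real^2) \<times> (real^2)) set" where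
  "tri_E_from e1 e2 x = {e \<in> tri_E e1 e2. fst e = x}"

text \<open>In the standard realization the arguments \<open>A\<close>, \<open>B\<close>, \<open>C\<close> are the symmetrized weights
  \<open>\<alpha> + \<alpha>'\<close>, \<open>\<beta> + \<beta>'\<close>, \<open>\<gamma> + \<gamma>'\<close>.\<close>

definition Gamma_w :: "real \<Rightarrow> real \<Rightarrow> real \<Rightarrow> real" where
  "Gamma_w A B C = A * B + B * C + C * A"

definition std_l :: "real \<Rightarrow> real \<Rightarrow> real \<Rightarrow> real" where
  "std_l A B C = sqrt ((B + C) / (3 * Gamma_w A B C))"

definition std_h1 :: "real \<Rightarrow> real \<Rightarrow> real \<Rightarrow> real^2" where
  "std_h1 A B C = vector [std_l A B C, 0]"

definition std_h2 :: "real \<Rightarrow> real \<Rightarrow> real \<Rightarrow> real^2" where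
  "std_h2 A B C = vector [C / (B + C) * std_l A B C, sqrt (Gamma_w A B C) / (B + C) * std_l A B C]"

text \<open>The weight \<open>p\<close> is a total function, but only its values on \<open>tri_E e1 e2\<close> matter. Note that
  the unprimed \<open>\<beta>\<close> belongs to the direction \<open>- e2\<close>. An edge \<open>e\<close> starting at the origin is
  identified with the vector \<open>snd e - fst e\<close>.\<close>

locale triangular_walk =
  fixes e1 e2 :: "real^2"
    and p :: "(real^2) \<times> (real^2) \<Rightarrow> real"
    and \<alpha> \<alpha>' \<beta> \<beta>' \<gamma> \<gamma>' :: real
  assumes lin_indep: "e1 \<noteq> e2" "independent {e1, e2}"
    and p_nonneg: "\<And>e. e \<in> tri_E e1 e2 \<Longrightarrow> 0 \<le> p e"
    and p_e1: "\<And>x. x \<in> tri_V e1 e2 \<Longrightarrow> p (x, x + e1) = \<alpha>"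
    and p_minus_e1: "\<And>x. x \<in> tri_V e1 e2 \<Longrightarrow> p (x, x - e1) = \<alpha>'"
    and p_e2: "\<And>x. x \<in> tri_V e1 e2 \<Longrightarrow> p (x, x + e2) = \<beta>'"
    and p_minus_e2: "\<And>x. x \<in> tri_V e1 e2 \<Longrightarrow> p (x, x - e2) = \<beta>"
    and p_e3: "\<And>x. x \<in> tri_V e1 e2 \<Longrightarrow> p (x, x + (e2 - e1)) = \<gamma>"
    and p_minus_e3: "\<And>x. x \<in> tri_V e1 e2 \<Longrightarrow> p (x, x - (e2 - e1)) = \<gamma>'"
    and weights_nonneg: "0 \<le> \<alpha>" "0 \<le> \<alpha>'" "0 \<le> \<beta>" "0 \<le> \<beta>'" "0 \<le> \<gamma>" "0 \<le> \<gamma>'"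
    and weights_sum: "\<alpha> + \<alpha>' + \<beta> + \<beta>' + \<gamma> + \<gamma>' = 1"
    and zero_mean: "(\<Sum>e \<in> tri_E_from e1 e2 0. p e *\<^sub>R (snd e - fst e)) = 0"
    and Gamma_pos: "0 < Gamma_w (\<alpha> + \<alpha>') (\<beta> + \<beta>') (\<gamma> + \<gamma>')"

text \<open>Functions on the vertex set are represented by total functions; for \<open>x \<in> tri_V e1 e2\<close> the
  value below involves only values of \<open>u\<close> at vertices.\<close>

definition trans_op ::
  "real^2 \<Rightarrow> real^2 \<Rightarrow> ((real^2) \<times> (real^2) \<Rightarrow> real) \<Rightarrow> (real^2 \<Rightarrow> real) \<Rightarrow> (real^2 \<Rightarrow> real)" where
  "trans_op e1 e2 p u = (\<lambda>x. \<Sum>e \<in> tri_E_from e1 e2 x. p e * u (snd e))"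

definition heat_op :: "real \<Rightarrow> (real^2 \<Rightarrow> real) \<Rightarrow> (real^2 \<Rightarrow> real)" where
  "heat_op t f = (\<lambda>x. 1 / (2 * pi * t) *
     (\<integral>z. exp (- (norm (x - z))\<^sup>2 / (2 * t)) * f z \<partial>lborel))"

text \<open>The linear independence required by \<^locale>\<open>triangular_walk\<close> is automatic in the standard
  realization.\<close>

lemma std_independent:
  assumes "0 \<le> A" "0 \<le> B" "0 \<le> C" "0 < Gamma_w A B C"
  shows "std_h1 A B C \<noteq> std_h2 A B C" "independent {std_h1 A B C, std_h2 A B C}"
proof -
  have BC: "0 < B + C"
  proof (rule ccontr)
    assume "\<not> 0 < B + C"
    then have "B = 0" "C = 0" using assms by auto
    then show False using assms by (simp add: Gamma_w_def)
  qed
  have l: "0 < std_l A B C" using BC assms by (simp add: std_l_def)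
  have y: "std_h2 A B C $ 2 \<noteq> 0" using BC assms l by (simp add: std_h2_def)
  have h1: "std_h1 A B C $ 1 \<noteq> 0" "std_h1 A B C $ 2 = 0"
    using l by (auto simp: std_h1_def)
  show ne: "std_h1 A B C \<noteq> std_h2 A B C" using y h1 by metis
  have "std_h2 A B C \<notin> span {std_h1 A B C}"
    using y h1 by (auto simp: span_singleton)
  moreover have "std_h1 A B C \<noteq> 0" using h1 by auto
  ultimately show "independent {std_h1 A B C, std_h2 A B C}"
    using ne by (subst insert_commute) (simp add: independent_insert)
qed

end

theory Submission
  imports Defs "HOL-Probability.Characteristic_Functions"
begin

text \<open>
  The statement is a central limit theorem. The number \<open>L\<^sup>n (f \<circ> \<delta>\<^sub>n) (x\<^sub>n)\<close> is the mean of \<open>f\<close> at the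
  rescaled position after \<open>n\<close> steps of the walk from \<open>x\<^sub>n\<close>. The lattice vectors of the standard
  realization are chosen so that one step has covariance \<open>1/3\<close> times the identity
  (\<open>isotropic_walk_standard\<close>). As \<open>n \<delta>\<^sub>n\<^sup>2 \<rightarrow> 3 t\<close>, the rescaled position has a Gaussian limit with
  mean \<open>x\<close> and covariance \<open>t\<close> times the identity, and \<open>H\<^sub>t f (x)\<close> is the mean of \<open>f\<close> under
  that Gaussian.

  The limit is first taken for trigonometric polynomials. The wave with frequency \<open>\<xi>\<close> is an
  eigenfunction of the translation invariant step operator. The \<open>n\<close>-th power of its eigenvalue at
  \<open>\<delta>\<^sub>n \<xi>\<close> tends to the Gaussian characteristic function by a second-order Taylor expansion
  (\<open>step_char_power_tendsto\<close>), and this is also the factor by which the Gaussian integral acts on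
  that wave (\<open>integral_gaussian_wave\<close>).

  To pass to a general \<open>f\<close>, a trigonometric polynomial \<open>q\<close> with
  \<open>\<bar>f z - q z\<bar> \<le> \<epsilon> (1 + \<bar>z\<bar>\<^sup>2)\<close> on the whole space is used (\<open>trig_poly_approximation\<close>). The
  quadratic weight replaces a separate tightness argument: the walk and the Gaussian are averages,
  so replacing \<open>f\<close> by \<open>q\<close> changes each of them by at most \<open>\<epsilon>\<close> times one plus its second moment.
  The second moment of the walk is known exactly (\<open>walk_power_quadratic\<close>) and is bounded in \<open>n\<close>.

  The limit theorem is proved for an arbitrary centered walk on a Euclidean space with finitely
  many steps and isotropic covariance, of which the triangular walk is an instance.
\<close>

section \<open>Approximation by trigonometric polynomials\<close>

text \<open>The phase \<open>\<theta>\<close> makes a single kind of generator cover constants and sines as well.\<close>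

inductive trig_poly :: "('a::euclidean_space \<Rightarrow> real) \<Rightarrow> bool" where
  wave: "trig_poly (\<lambda>z. c * cos (\<xi> \<bullet> z + \<theta>))"
| add: "trig_poly f \<Longrightarrow> trig_poly g \<Longrightarrow> trig_poly (\<lambda>z. f z + g z)"

lemma trig_poly_const: "trig_poly (\<lambda>z. c)"
  using trig_poly.wave[of c 0 0] by simp

lemma trig_poly_sin: "trig_poly (\<lambda>z. sin (\<xi> \<bullet> z))"
  using trig_poly.wave[of 1 \<xi> "- pi / 2"] by (simp add: cos_diff)

text \<open>By the product-to-sum formula for cosines.\<close>

lemma trig_poly_mult_wave:
  assumes "trig_poly f"
  shows "trig_poly (\<lambda>z. c * cos (\<xi> \<bullet> z + \<theta>) * f z)"
  using assms
proof induction
  case (wave d \<eta> \<rho>)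
  have "(\<lambda>z. c * cos (\<xi> \<bullet> z + \<theta>) * (d * cos (\<eta> \<bullet> z + \<rho>))) =
    (\<lambda>z. c * d / 2 * cos ((\<xi> - \<eta>) \<bullet> z + (\<theta> - \<rho>)) + c * d / 2 * cos ((\<xi> + \<eta>) \<bullet> z + (\<theta> + \<rho>)))"
  proof
    fix z
    have "(\<xi> - \<eta>) \<bullet> z + (\<theta> - \<rho>) = (\<xi> \<bullet> z + \<theta>) - (\<eta> \<bullet> z + \<rho>)"
      "(\<xi> + \<eta>) \<bullet> z + (\<theta> + \<rho>) = (\<xi> \<bullet> z + \<theta>) + (\<eta> \<bullet> z + \<rho>)"
      by (simp_all add: inner_diff_left inner_add_left)
    then show "c * cos (\<xi> \<bullet> z + \<theta>) * (d * cos (\<eta> \<bullet> z + \<rho>)) =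
      c * d / 2 * cos ((\<xi> - \<eta>) \<bullet> z + (\<theta> - \<rho>)) + c * d / 2 * cos ((\<xi> + \<eta>) \<bullet> z + (\<theta> + \<rho>))"
      by (simp only: cos_diff cos_add) (simp add: algebra_simps)
  qed
  then show ?case
    by (simp only:) (intro trig_poly.add trig_poly.wave)
next
  case (add f g)
  then show ?case
    by (simp only: distrib_left) (rule trig_poly.add)
qed

lemma trig_poly_mult:
  assumes "trig_poly f" "trig_poly g"
  shows "trig_poly (\<lambda>z. f z * g z)"
  using assms(1)
proof induction
  case (wave c \<xi> \<theta>)
  show ?case by (rule trig_poly_mult_wave) fact
next
  case (add f1 f2)
  then show ?case
    by (simp only: distrib_right) (rule trig_poly.add)
qed

lemma trig_poly_sum:
  assumes "\<And>i. i \<in> I \<Longrightarrow> trig_poly (f i)"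
  shows "trig_poly (\<lambda>z. \<Sum>i\<in>I. f i z)"
  using assms
  by (induction I rule: infinite_finite_induct) (auto intro: trig_poly_const trig_poly.add)

text \<open>This turns the algebraic polynomials delivered by the Stone-Weierstrass theorem into
  trigonometric ones.\<close>

lemma trig_poly_polynomial_of_sines:
  assumes "real_polynomial_function P"
  shows "trig_poly (\<lambda>z::'a::euclidean_space. P (\<Sum>b\<in>Basis. sin ((z \<bullet> b) / R) *\<^sub>R b))"
  using assms
proof induction
  case (linear P)
  interpret bounded_linear P by fact
  have "trig_poly (\<lambda>z. sin ((z \<bullet> b) / R) * P b)" for b
    using trig_poly_mult[OF trig_poly_sin trig_poly_const, of "(1 / R) *\<^sub>R b" "P b"]
    by (simp add: inner_commute)
  then show ?case
    by (simp add: sum scaleR trig_poly_sum)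
next
  case (const c)
  show ?case by (rule trig_poly_const)
next
  case (add f g)
  then show ?case by (intro trig_poly.add)
next
  case (mult f g)
  then show ?case by (intro trig_poly_mult)
qed

text \<open>The substitution \<open>s\<^sub>b = sin (z\<^sub>b / R)\<close> maps the whole space into the compact cube
  \<open>[-1, 1]\<^sup>d\<close>. Near the origin it is inverted by the arcsine, so that a polynomial in \<open>s\<close> close to
  the transported function is close to \<open>f\<close> on a box of size \<open>R\<close>. Outside the box there is no
  closeness, but both functions stay bounded by about \<open>K\<close>, because the transported function only
  takes values of \<open>f\<close>. There the quadratic weight absorbs the error if \<open>R\<close> is large.\<close>

theorem trig_poly_approximation:
  fixes f :: "'a::euclidean_space \<Rightarrow> real"
  assumes f: "continuous_on UNIV f" and K: "\<And>z. \<bar>f z\<bar> \<le> K" and "0 < \<epsilon>"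
  obtains q where "trig_poly q" "\<And>z. \<bar>f z - q z\<bar> \<le> \<epsilon> * (1 + (norm z)\<^sup>2)"
proof -
  \<comment> \<open>chosen so that \<open>\<epsilon> R\<^sup>2\<close> equals the crude error \<open>2 K + \<epsilon>\<close> outside the box\<close>
  define R where "R = sqrt ((2 * K + \<epsilon>) / \<epsilon>)"
  have "0 \<le> K" using K[of 0] by linarith
  then have R: "0 < R" "\<epsilon> * R\<^sup>2 = 2 * K + \<epsilon>"
    using \<open>0 < \<epsilon>\<close> by (simp_all add: R_def)
  let ?Q = "cbox (- One) One :: 'a set"
  define sines :: "'a \<Rightarrow> 'a" where "sines z = (\<Sum>b\<in>Basis. sin ((z \<bullet> b) / R) *\<^sub>R b)" for z
  define g where "g s = f (\<Sum>b\<in>Basis. (R * arcsin (s \<bullet> b)) *\<^sub>R b)" for s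
  have "continuous_on ?Q (\<lambda>s. f (\<Sum>b\<in>Basis. (R * arcsin (s \<bullet> b)) *\<^sub>R b))"
    by (rule continuous_on_compose2[OF f])
      (auto intro!: continuous_intros simp: mem_box)
  then have "continuous_on ?Q g" unfolding g_def .
  then obtain P where P: "real_polynomial_function P" "\<And>s. s \<in> ?Q \<Longrightarrow> \<bar>g s - P s\<bar> < \<epsilon>"
    using Stone_Weierstrass_real_polynomial_function[OF compact_cbox _ \<open>0 < \<epsilon>\<close>] by metis
  have sines_Q: "sines z \<in> ?Q" for z
    by (auto simp: mem_box sines_def)
  have "\<bar>f z - P (sines z)\<bar> \<le> \<epsilon> * (1 + (norm z)\<^sup>2)" for z
  proof (cases "\<forall>b\<in>Basis. \<bar>z \<bullet> b\<bar> \<le> R")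
    case True
    have "arcsin (sin ((z \<bullet> b) / R)) = (z \<bullet> b) / R" if "b \<in> Basis" for b
    proof -
      have "\<bar>(z \<bullet> b) / R\<bar> \<le> 1" using True that R by simp
      then show ?thesis using pi_ge_two by (intro arcsin_sin) linarith+
    qed
    then have "g (sines z) = f z"
      using R by (simp add: g_def sines_def euclidean_representation)
    with P(2)[OF sines_Q[of z]] have "\<bar>f z - P (sines z)\<bar> \<le> \<epsilon>" by simp
    also have "\<dots> \<le> \<epsilon> * (1 + (norm z)\<^sup>2)" using \<open>0 < \<epsilon>\<close> by simp
    finally show ?thesis .
  next
    case False
    then obtain b where "b \<in> Basis" "R < \<bar>z \<bullet> b\<bar>" by (auto simp: not_le)
    with Basis_le_norm[of b z] have "R \<le> norm z" by linarith
    then have "R\<^sup>2 \<le> (norm z)\<^sup>2" using R by (intro power_mono) auto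
    then have "\<epsilon> * R\<^sup>2 \<le> \<epsilon> * (norm z)\<^sup>2" using \<open>0 < \<epsilon>\<close> by simp
    moreover have "\<bar>f z - P (sines z)\<bar> \<le> 2 * K + \<epsilon>"
    proof -
      have "\<bar>g (sines z)\<bar> \<le> K" by (simp add: g_def K)
      with P(2)[OF sines_Q[of z]] K[of z] show ?thesis by linarith
    qed
    ultimately show ?thesis using R \<open>0 < \<epsilon>\<close> by (simp add: distrib_left)
  qed
  moreover have "trig_poly (\<lambda>z. P (sines z))"
    unfolding sines_def by (rule trig_poly_polynomial_of_sines) fact
  ultimately show thesis by (rule that[rotated])
qed

section \<open>The Gaussian density\<close>

text \<open>Fubini's theorem for products of functions of one coordinate; Lebesgue measure on a Euclidean
  space is the image of the product measure over the basis.\<close>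

lemma
  fixes f :: "'a::euclidean_space \<Rightarrow> real \<Rightarrow> 'b::{real_normed_field,banach,second_countable_topology}"
  assumes f: "\<And>b. b \<in> Basis \<Longrightarrow> integrable lborel (f b)"
  shows integrable_lborel_prod: "integrable lborel (\<lambda>z. \<Prod>b\<in>Basis. f b (z \<bullet> b))"
    and integral_lborel_prod:
      "(\<integral>z. (\<Prod>b\<in>Basis. f b (z \<bullet> b)) \<partial>lborel) = (\<Prod>b\<in>Basis. \<integral>s. f b s \<partial>lborel)"
proof -
  interpret product_sigma_finite "\<lambda>_::'a. lborel :: real measure"
    by standard
  have [measurable]: "f b \<in> borel_measurable borel" if "b \<in> Basis" for b
    using borel_measurable_integrable[OF f[OF that]] by simp
  have [measurable]: "(\<lambda>z. \<Prod>b\<in>Basis. f b (z \<bullet> b)) \<in> borel_measurable borel"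
    by measurable
  have proj: "(\<Prod>b\<in>Basis. f b ((\<Sum>c\<in>Basis. x c *\<^sub>R c) \<bullet> b)) = (\<Prod>b\<in>Basis. f b (x b))" for x
    by (intro prod.cong refl) simp
  show "integrable lborel (\<lambda>z. \<Prod>b\<in>Basis. f b (z \<bullet> b))"
    unfolding lborel_eq[where 'a='a]
    by (subst integrable_distr_eq) (auto simp: proj intro!: product_integrable_prod f)
  show "(\<integral>z. (\<Prod>b\<in>Basis. f b (z \<bullet> b)) \<partial>lborel) = (\<Prod>b\<in>Basis. \<integral>s. f b s \<partial>lborel)"
    unfolding lborel_eq[where 'a='a]
    by (subst integral_distr) (auto simp: proj intro!: product_integral_prod f)
qed

lemma integrable_normal_second_moment:
  assumes "0 < \<sigma>"
  shows "integrable lborel (\<lambda>s. normal_density \<mu> \<sigma> s * s\<^sup>2)"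
proof -
  have "(\<lambda>s. normal_density \<mu> \<sigma> s * s\<^sup>2) = (\<lambda>s. normal_density \<mu> \<sigma> s * (s - \<mu>)\<^sup>2 +
      2 * \<mu> * (normal_density \<mu> \<sigma> s * s) - \<mu>\<^sup>2 * normal_density \<mu> \<sigma> s)"
    by (auto simp: power2_eq_square algebra_simps)
  then show ?thesis
    using assms integrable_normal_moment[OF assms, of \<mu> 2]
    by (simp add: integrable_normal_moment_nz_1)
qed

text \<open>The substitution \<open>s = \<mu> + \<sigma> u\<close> reduces this to the characteristic function of the standard
  normal distribution.\<close>

lemma
  assumes "0 < \<sigma>"
  shows integrable_normal_cis: "integrable lborel (\<lambda>s. normal_density \<mu> \<sigma> s *\<^sub>R cis (\<xi> * s))" (is ?int)
    and integral_normal_cis: "(\<integral>s. normal_density \<mu> \<sigma> s *\<^sub>R cis (\<xi> * s) \<partial>lborel) =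
      complex_of_real (exp (- (\<sigma> * \<xi>)\<^sup>2 / 2)) * cis (\<xi> * \<mu>)" (is ?eq)
proof -
  \<comment> \<open>a wave has modulus one, so the density itself dominates\<close>
  show ?int
    by (rule Bochner_Integration.integrable_bound[OF integrable_normal_density[OF assms, of \<mu>]])
       (auto intro!: borel_measurable_scaleR
          borel_measurable_continuous_onI[of "\<lambda>s. cis (\<xi> * s)"] continuous_intros)
  have std: "(\<integral>u. std_normal_density u *\<^sub>R cis (\<eta> * u) \<partial>lborel) = exp (- \<eta>\<^sup>2 / 2)" for \<eta>
  proof -
    have "(\<integral>u. std_normal_density u *\<^sub>R iexp (\<eta> * u) \<partial>lborel) = char std_normal_distribution \<eta>"
      unfolding char_def by (subst integral_density) auto
    then show ?thesis
      by (simp add: char_std_normal_distribution cis_conv_exp)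
  qed
  have nd: "\<sigma> * normal_density \<mu> \<sigma> (\<mu> + \<sigma> * u) = std_normal_density u" for u
    using assms by (simp add: normal_density_def real_sqrt_mult power_mult_distrib)
  have "(\<integral>s. normal_density \<mu> \<sigma> s *\<^sub>R cis (\<xi> * s) \<partial>lborel) =
      \<bar>\<sigma>\<bar> *\<^sub>R (\<integral>u. normal_density \<mu> \<sigma> (\<mu> + \<sigma> * u) *\<^sub>R cis (\<xi> * (\<mu> + \<sigma> * u)) \<partial>lborel)"
    using assms by (intro lborel_integral_real_affine) simp
  also have "\<dots> = (\<integral>u. (\<sigma> * normal_density \<mu> \<sigma> (\<mu> + \<sigma> * u)) *\<^sub>R cis (\<xi> * (\<mu> + \<sigma> * u)) \<partial>lborel)"
    using assms by (simp flip: integral_scaleR_right)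
  also have "\<dots> = (\<integral>u. cis (\<xi> * \<mu>) * (std_normal_density u *\<^sub>R cis ((\<sigma> * \<xi>) * u)) \<partial>lborel)"
    by (simp only: nd distrib_left flip: cis_mult) (simp add: mult_ac)
  also have "\<dots> = cis (\<xi> * \<mu>) * exp (- (\<sigma> * \<xi>)\<^sup>2 / 2)"
    unfolding std[symmetric] by (rule integral_mult_right_zero)
  finally show ?eq by (simp add: mult.commute)
qed

text \<open>The density of the normal distribution with mean \<open>x\<close> and covariance \<open>t\<close> times the identity,
  written as a product so that integrals against it factor over the coordinates.\<close>

definition gaussian_density :: "real \<Rightarrow> 'a::euclidean_space \<Rightarrow> 'a \<Rightarrow> real" where
  "gaussian_density t x z = (\<Prod>b\<in>Basis. normal_density (x \<bullet> b) (sqrt t) (z \<bullet> b))"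

lemma gaussian_density_nonneg: "0 \<le> gaussian_density t x z"
  by (simp add: gaussian_density_def prod_nonneg)

lemma integrable_gaussian_density:
  fixes x :: "'a::euclidean_space"
  assumes "0 < t"
  shows "integrable lborel (gaussian_density t x)"
  using assms integrable_lborel_prod[of "\<lambda>b. normal_density (x \<bullet> b) (sqrt t)"]
  by (simp add: gaussian_density_def[abs_def])

lemma integrable_gaussian_bounded:
  fixes x :: "'a::euclidean_space"
  assumes "0 < t" "g \<in> borel_measurable borel" "\<And>z. \<bar>g z\<bar> \<le> K"
  shows "integrable lborel (\<lambda>z. gaussian_density t x z * g z)"
proof (rule Bochner_Integration.integrable_bound)
  show "integrable lborel (\<lambda>z. K * gaussian_density t x z)"
    using integrable_gaussian_density[OF assms(1), of x] by simp
  show "(\<lambda>z. gaussian_density t x z * g z) \<in> borel_measurable lborel"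
    using assms(2) borel_measurable_integrable[OF integrable_gaussian_density[OF assms(1), of x]]
    by simp
  show "AE z in lborel. norm (gaussian_density t x z * g z) \<le> norm (K * gaussian_density t x z)"
    using assms(3) by (auto simp: abs_mult gaussian_density_nonneg mult.commute[of K]
      intro!: mult_left_mono order_trans[OF assms(3)])
qed

lemma integrable_gaussian_second_moment:
  fixes x :: "'a::euclidean_space"
  assumes "0 < t"
  shows "integrable lborel (\<lambda>z. gaussian_density t x z * (norm z)\<^sup>2)"
proof -
  have "integrable lborel (\<lambda>z. gaussian_density t x z * (z \<bullet> b)\<^sup>2)" if b: "b \<in> Basis" for b
  proof -
    let ?n = "\<lambda>c. normal_density (x \<bullet> c) (sqrt t)"
    \<comment> \<open>the factor \<open>(z \<bullet> b)\<^sup>2\<close> is distributed over the coordinates, as \<open>1\<close> in all but one of them\<close>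
    have "integrable lborel (\<lambda>s. ?n c s * (if c = b then s\<^sup>2 else 1))" for c
      using assms by (cases "c = b") (simp_all add: integrable_normal_second_moment)
    then have "integrable lborel (\<lambda>z. \<Prod>c\<in>Basis. ?n c (z \<bullet> c) * (if c = b then (z \<bullet> c)\<^sup>2 else 1))"
      by (intro integrable_lborel_prod[where f = "\<lambda>c s. ?n c s * (if c = b then s\<^sup>2 else 1)"])
    then show ?thesis
      using b by (simp add: gaussian_density_def prod.distrib prod.delta)
  qed
  then have "integrable lborel (\<lambda>z. \<Sum>b\<in>Basis. gaussian_density t x z * (z \<bullet> b)\<^sup>2)"
    by (rule Bochner_Integration.integrable_sum)
  moreover have "(norm z)\<^sup>2 = (\<Sum>b\<in>Basis. (z \<bullet> b)\<^sup>2)" for z :: 'a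
    by (subst power2_norm_eq_inner, subst euclidean_inner) (simp add: power2_eq_square)
  ultimately show ?thesis by (simp add: sum_distrib_left)
qed

lemma
  fixes x :: "'a::euclidean_space"
  assumes "0 < t"
  shows integrable_gaussian_cis: "integrable lborel (\<lambda>z. gaussian_density t x z *\<^sub>R cis (\<xi> \<bullet> z))"
    and integral_gaussian_cis: "(\<integral>z. gaussian_density t x z *\<^sub>R cis (\<xi> \<bullet> z) \<partial>lborel) =
      complex_of_real (exp (- t * (norm \<xi>)\<^sup>2 / 2)) * cis (\<xi> \<bullet> x)"
proof -
  let ?f = "\<lambda>b s. normal_density (x \<bullet> b) (sqrt t) s *\<^sub>R cis ((\<xi> \<bullet> b) * s)"
  have cis_sum: "cis (\<Sum>i\<in>I. a i) = (\<Prod>i\<in>I. cis (a i))" for a :: "'a \<Rightarrow> real" and I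
    by (induction I rule: infinite_finite_induct) (auto simp flip: cis_mult)
  have cis_inner: "cis (\<xi> \<bullet> z) = (\<Prod>b\<in>Basis. cis ((\<xi> \<bullet> b) * (z \<bullet> b)))" for z
    by (subst euclidean_inner) (rule cis_sum)
  have prod: "gaussian_density t x z *\<^sub>R cis (\<xi> \<bullet> z) = (\<Prod>b\<in>Basis. ?f b (z \<bullet> b))" for z
    by (simp add: gaussian_density_def cis_inner scaleR_conv_of_real prod.distrib)
  have int: "integrable lborel (?f b)" for b
    using assms by (intro integrable_normal_cis) simp
  show "integrable lborel (\<lambda>z. gaussian_density t x z *\<^sub>R cis (\<xi> \<bullet> z))"
    unfolding prod by (rule integrable_lborel_prod) (rule int)
  have "(\<integral>z. gaussian_density t x z *\<^sub>R cis (\<xi> \<bullet> z) \<partial>lborel) = (\<Prod>b\<in>Basis. \<integral>s. ?f b s \<partial>lborel)"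
    unfolding prod by (rule integral_lborel_prod) (rule int)
  also have "\<dots> = (\<Prod>b\<in>Basis. complex_of_real (exp (- t * (\<xi> \<bullet> b)\<^sup>2 / 2)) * cis ((\<xi> \<bullet> b) * (x \<bullet> b)))"
    using assms by (intro prod.cong refl, subst integral_normal_cis) (simp_all add: power_mult_distrib)
  also have "\<dots> = complex_of_real (exp (\<Sum>b\<in>Basis. - t * (\<xi> \<bullet> b)\<^sup>2 / 2)) * cis (\<xi> \<bullet> x)"
    by (simp add: prod.distrib cis_inner exp_sum)
  also have "(\<Sum>b\<in>Basis. - t * (\<xi> \<bullet> b)\<^sup>2 / 2) = - t * (norm \<xi>)\<^sup>2 / 2"
    unfolding power2_norm_eq_inner[of \<xi>] euclidean_inner[of \<xi> \<xi>]
    by (simp add: power2_eq_square sum_distrib_left sum_negf sum_divide_distrib)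
  finally show "(\<integral>z. gaussian_density t x z *\<^sub>R cis (\<xi> \<bullet> z) \<partial>lborel) =
      complex_of_real (exp (- t * (norm \<xi>)\<^sup>2 / 2)) * cis (\<xi> \<bullet> x)" .
qed

lemma integrable_gaussian_trig_poly:
  fixes x :: "'a::euclidean_space"
  assumes "0 < t" "trig_poly q"
  shows "integrable lborel (\<lambda>z. gaussian_density t x z * q z)"
  using assms(2)
proof induction
  case (wave c \<xi> \<theta>)
  have "\<bar>c * cos (\<xi> \<bullet> z + \<theta>)\<bar> \<le> \<bar>c\<bar>" for z
    by (simp add: abs_mult mult_left_le)
  then show ?case
    by (intro integrable_gaussian_bounded assms(1) borel_measurable_continuous_onI continuous_intros)
next
  case (add f g)
  then show ?case by (simp add: distrib_left)
qed

text \<open>Waves are eigenfunctions of the heat operator.\<close>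

lemma integral_gaussian_wave:
  fixes x :: "'a::euclidean_space"
  assumes "0 < t"
  shows "(\<integral>z. gaussian_density t x z * cos (\<xi> \<bullet> z + \<theta>) \<partial>lborel) =
    exp (- t * (norm \<xi>)\<^sup>2 / 2) * cos (\<xi> \<bullet> x + \<theta>)"
proof -
  let ?F = "\<lambda>z. cis \<theta> * (gaussian_density t x z *\<^sub>R cis (\<xi> \<bullet> z))"
  have "(\<integral>z. gaussian_density t x z * cos (\<xi> \<bullet> z + \<theta>) \<partial>lborel) = (\<integral>z. Re (?F z) \<partial>lborel)"
    by (intro Bochner_Integration.integral_cong) (auto simp: cos_add algebra_simps)
  also have "\<dots> = Re (\<integral>z. ?F z \<partial>lborel)"
    by (intro integral_Re integrable_mult_right integrable_gaussian_cis assms)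
  also have "\<dots> = exp (- t * (norm \<xi>)\<^sup>2 / 2) * cos (\<xi> \<bullet> x + \<theta>)"
    by (simp only: integral_mult_right_zero integral_gaussian_cis[OF assms])
       (simp add: cos_add algebra_simps)
  finally show ?thesis .
qed

lemma heat_op_eq_gaussian_integral:
  assumes "0 < t"
  shows "heat_op t f x = (\<integral>z. gaussian_density t x z * f z \<partial>lborel)"
proof -
  have "gaussian_density t x z = 1 / (2 * pi * t) * exp (- (norm (x - z))\<^sup>2 / (2 * t))" for z
  proof -
    have "(norm (x - z))\<^sup>2 = (\<Sum>b\<in>Basis. (z \<bullet> b - x \<bullet> b)\<^sup>2)"
      unfolding power2_norm_eq_inner euclidean_inner[of "x - z" "x - z"]
      by (simp add: power2_eq_square inner_diff_left algebra_simps)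
    then have "exp (- (norm (x - z))\<^sup>2 / (2 * t)) = (\<Prod>b\<in>Basis. exp (- (z \<bullet> b - x \<bullet> b)\<^sup>2 / (2 * t)))"
      by (simp add: exp_sum[symmetric] sum_divide_distrib sum_negf)
    then show ?thesis
      using assms
      by (simp add: gaussian_density_def normal_density_def prod.distrib prod_dividef power_divide)
  qed
  then show ?thesis
    by (simp add: heat_op_def mult.assoc)
qed

section \<open>Random walks with finitely many steps\<close>

text \<open>A step \<open>v\<close> is taken with weight \<open>w v\<close>. Complex-valued functions are allowed, since the waves
  \<open>cis (\<xi> \<bullet> y)\<close>, unlike their real parts, are eigenfunctions of an asymmetric walk.\<close>

definition walk_op ::
  "'a set \<Rightarrow> ('a \<Rightarrow> real) \<Rightarrow> ('a::ab_group_add \<Rightarrow> 'b::real_vector) \<Rightarrow> 'a \<Rightarrow> 'b" where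
  "walk_op S w u = (\<lambda>x. \<Sum>v\<in>S. w v *\<^sub>R u (x + v))"

lemma walk_op_power_add:
  "(walk_op S w ^^ n) (\<lambda>y. u y + u' y) = (\<lambda>x. (walk_op S w ^^ n) u x + (walk_op S w ^^ n) u' x)"
  by (induction n) (simp_all add: walk_op_def scaleR_add_right sum.distrib)

lemma walk_op_power_linear:
  assumes "linear h"
  shows "(walk_op S w ^^ n) (\<lambda>y. h (u y)) = (\<lambda>x. h ((walk_op S w ^^ n) u x))"
  by (induction n) (simp_all add: walk_op_def linear_sum[OF assms] linear_scale[OF assms])

lemma walk_op_power_diff:
  "(walk_op S w ^^ n) (\<lambda>y. u y - u' y) = (\<lambda>x. (walk_op S w ^^ n) u x - (walk_op S w ^^ n) u' x)"
  by (induction n) (simp_all add: walk_op_def scaleR_diff_right sum_subtractf)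

text \<open>The number \<open>\<kappa>\<close> is the variance of a single step in every direction. The set of steps is
  finite, since a sum over an infinite set would be \<open>0\<close> and not \<open>1\<close>.\<close>

locale isotropic_walk =
  fixes S :: "'a::euclidean_space set" and w :: "'a \<Rightarrow> real" and \<kappa> :: real
  assumes weight_nonneg: "\<And>v. v \<in> S \<Longrightarrow> 0 \<le> w v"
    and total_weight: "(\<Sum>v\<in>S. w v) = 1"
    and drift_zero: "(\<Sum>v\<in>S. w v *\<^sub>R v) = 0"
    and isotropic: "\<And>\<xi>. (\<Sum>v\<in>S. w v * (\<xi> \<bullet> v)\<^sup>2) = \<kappa> * (norm \<xi>)\<^sup>2"
begin

abbreviation W :: "('a \<Rightarrow> 'b::real_vector) \<Rightarrow> 'a \<Rightarrow> 'b" where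
  "W \<equiv> walk_op S w"

lemma drift_zero_inner: "(\<Sum>v\<in>S. w v * (\<xi> \<bullet> v)) = 0"
  using arg_cong[OF drift_zero, of "inner \<xi>"] by (simp add: inner_sum_right)

lemma variance_nonneg:
  fixes \<xi> :: 'a
  shows "0 \<le> \<kappa> * (norm \<xi>)\<^sup>2"
  unfolding isotropic[of \<xi>, symmetric] by (intro sum_nonneg) (simp add: weight_nonneg)

text \<open>Averages with nonnegative weights preserve domination.\<close>

lemma walk_power_norm_le:
  assumes "\<And>y. norm (u y) \<le> g y"
  shows "norm ((W ^^ n) u x) \<le> (W ^^ n) g x"
proof (induction n arbitrary: x)
  case 0
  show ?case using assms by simp
next
  case (Suc n)
  have "norm ((W ^^ Suc n) u x) \<le> (\<Sum>v\<in>S. norm (w v *\<^sub>R (W ^^ n) u (x + v)))"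
    by (simp only: funpow.simps o_apply walk_op_def[of _ _ "(W ^^ n) u"] norm_sum)
  also have "\<dots> \<le> (\<Sum>v\<in>S. w v *\<^sub>R (W ^^ n) g (x + v))"
    using Suc by (intro sum_mono) (simp add: weight_nonneg mult_left_mono)
  finally show ?case by (simp add: walk_op_def[of _ _ "(W ^^ n) _"])
qed

text \<open>The mixed term of \<open>(norm (x + v))\<^sup>2\<close> averages to zero over the centered steps, so each step
  adds the same amount to the second moment.\<close>

lemma walk_power_quadratic:
  fixes a c :: real
  shows "(W ^^ n) (\<lambda>y. a + c * (norm y)\<^sup>2) x =
    a + c * ((norm x)\<^sup>2 + real n * (\<Sum>v\<in>S. w v * (norm v)\<^sup>2))"
proof (induction n arbitrary: x)
  case 0
  show ?case by simp
next
  case (Suc n)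
  let ?\<tau> = "\<Sum>v\<in>S. w v * (norm v)\<^sup>2"
  have "(W ^^ Suc n) (\<lambda>y. a + c * (norm y)\<^sup>2) x =
      (\<Sum>v\<in>S. w v * (a + c * ((norm (x + v))\<^sup>2 + real n * ?\<tau>)))"
    by (simp add: walk_op_def[of _ _ "(W ^^ n) _"] Suc)
  also have "\<dots> = (\<Sum>v\<in>S. (a + c * ((norm x)\<^sup>2 + real n * ?\<tau>)) * w v
      + 2 * c * (w v * (x \<bullet> v)) + c * (w v * (norm v)\<^sup>2))"
    by (intro sum.cong refl) (simp add: power2_norm_eq_inner inner_add_left inner_add_right
        inner_commute algebra_simps)
  also have "\<dots> = (a + c * ((norm x)\<^sup>2 + real n * ?\<tau>)) * 1 + 2 * c * 0 + c * ?\<tau>"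
    by (simp only: sum.distrib total_weight drift_zero_inner flip: sum_distrib_left)
  also have "\<dots> = a + c * ((norm x)\<^sup>2 + real (Suc n) * ?\<tau>)"
    by (simp add: algebra_simps)
  finally show ?case .
qed

text \<open>This is both the characteristic function of one step and the eigenvalue of \<open>W\<close> on the wave of
  frequency \<open>\<xi>\<close>.\<close>

definition step_char :: "'a \<Rightarrow> complex" where
  "step_char \<xi> = (\<Sum>v\<in>S. w v *\<^sub>R cis (\<xi> \<bullet> v))"

lemma walk_power_wave:
  "(W ^^ n) (\<lambda>y. cis (\<xi> \<bullet> y + \<theta>)) x = step_char \<xi> ^ n * cis (\<xi> \<bullet> x + \<theta>)"
proof (induction n arbitrary: x)
  case (Suc n)
  have "cis (\<xi> \<bullet> (x + v) + \<theta>) = cis (\<xi> \<bullet> v) * cis (\<xi> \<bullet> x + \<theta>)" for v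
    by (simp add: cis_mult inner_add_right ac_simps)
  then show ?case
    by (simp add: walk_op_def[of _ _ "(W ^^ n) _"] Suc step_char_def sum_distrib_left
        sum_distrib_right mult_ac)
qed simp

lemma norm_step_char_le_1: "norm (step_char \<xi>) \<le> 1"
proof -
  have "norm (step_char \<xi>) \<le> (\<Sum>v\<in>S. norm (w v *\<^sub>R cis (\<xi> \<bullet> v)))"
    unfolding step_char_def by (rule norm_sum)
  also have "\<dots> = (\<Sum>v\<in>S. w v)"
    by (intro sum.cong) (auto simp: weight_nonneg)
  finally show ?thesis by (simp add: total_weight)
qed

text \<open>The Taylor expansion of \<open>cis\<close> to second order: the linear term vanishes because the walk is
  centered, and isotropy evaluates the quadratic one.\<close>

lemma step_char_approx:
  "norm (step_char \<xi> - of_real (1 - \<kappa> * (norm \<xi>)\<^sup>2 / 2)) \<le> (\<Sum>v\<in>S. w v * \<bar>\<xi> \<bullet> v\<bar> ^ 3)"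
proof -
  let ?p = "\<lambda>s::real. 1 + \<i> * s - of_real (s\<^sup>2 / 2)"
  have cis_approx: "norm (cis s - ?p s) \<le> \<bar>s\<bar> ^ 3" for s
  proof -
    have "norm (cis s - ?p s) \<le> \<bar>s\<bar> ^ 3 / 6"
      using iexp_approx1[of s 2]
      by (simp add: cis_conv_exp eval_nat_numeral power2_eq_square algebra_simps)
    also have "\<dots> \<le> \<bar>s\<bar> ^ 3" by simp
    finally show ?thesis .
  qed
  have "(\<Sum>v\<in>S. w v *\<^sub>R ?p (\<xi> \<bullet> v)) =
      of_real (\<Sum>v\<in>S. w v) + \<i> * of_real (\<Sum>v\<in>S. w v * (\<xi> \<bullet> v))
        - of_real ((\<Sum>v\<in>S. w v * (\<xi> \<bullet> v)\<^sup>2) / 2)"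
    by (simp add: scaleR_conv_of_real sum.distrib sum_subtractf sum_distrib_left
        sum_divide_distrib algebra_simps)
  then have "step_char \<xi> - of_real (1 - \<kappa> * (norm \<xi>)\<^sup>2 / 2) =
      (\<Sum>v\<in>S. w v *\<^sub>R (cis (\<xi> \<bullet> v) - ?p (\<xi> \<bullet> v)))"
    by (simp add: total_weight drift_zero_inner isotropic step_char_def scaleR_diff_right
        sum_subtractf)
  also have "norm \<dots> \<le> (\<Sum>v\<in>S. norm (w v *\<^sub>R (cis (\<xi> \<bullet> v) - ?p (\<xi> \<bullet> v))))"
    by (rule norm_sum)
  also have "\<dots> \<le> (\<Sum>v\<in>S. w v * \<bar>\<xi> \<bullet> v\<bar> ^ 3)"
    using cis_approx by (intro sum_mono) (simp add: weight_nonneg mult_left_mono)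
  finally show ?thesis .
qed

text \<open>The factor \<open>step_char (\<delta>\<^sub>n \<xi>)\<close> and the Gaussian \<open>\<psi>\<^sub>n = exp (- a \<delta>\<^sub>n\<^sup>2)\<close> have the same
  second-order expansion, so they differ by \<open>O(\<delta>\<^sub>n\<^sup>3)\<close>. Both have modulus at most one, so their
  \<open>n\<close>-th powers differ by at most \<open>n O(\<delta>\<^sub>n\<^sup>3)\<close>, which tends to zero as \<open>n \<delta>\<^sub>n\<^sup>2\<close> converges. The
  power of \<open>\<psi>\<^sub>n\<close> is explicit.\<close>

lemma step_char_power_tendsto:
  fixes \<delta> :: "nat \<Rightarrow> real"
  assumes scaling: "(\<lambda>n. real n * (\<delta> n)\<^sup>2) \<longlonglongrightarrow> s"
  shows "(\<lambda>n. step_char (\<delta> n *\<^sub>R \<xi>) ^ n) \<longlonglongrightarrow> of_real (exp (- (\<kappa> * s) * (norm \<xi>)\<^sup>2 / 2))"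
proof -
  define a where "a = \<kappa> * (norm \<xi>)\<^sup>2 / 2"
  define M where "M = (\<Sum>v\<in>S. w v * \<bar>\<xi> \<bullet> v\<bar> ^ 3)"
  define \<psi> :: "nat \<Rightarrow> complex" where "\<psi> n = of_real (exp (- (a * (\<delta> n)\<^sup>2)))" for n
  have a: "0 \<le> a" using variance_nonneg[of \<xi>] by (simp add: a_def)
  have "(\<lambda>n. real n * (\<delta> n)\<^sup>2 * inverse (real n)) \<longlonglongrightarrow> 0"
    using tendsto_mult[OF scaling lim_inverse_n] by simp
  then have "(\<lambda>n. (\<delta> n)\<^sup>2) \<longlonglongrightarrow> 0"
    by (rule Lim_transform_eventually)
       (auto intro!: eventually_mono[OF eventually_gt_at_top[of 0]])
  from tendsto_real_sqrt[OF this] have \<delta>0: "(\<lambda>n. \<bar>\<delta> n\<bar>) \<longlonglongrightarrow> 0" by simp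

  have exp_approx: "\<bar>(1 - y) - exp (- y)\<bar> \<le> y\<^sup>2" if "0 \<le> y" for y :: real
  proof -
    have "1 - y \<le> exp (- y)" using exp_ge_add_one_self[of "- y"] by simp
    moreover have "exp (- y) \<le> 1 / (1 + y)"
      using exp_ge_add_one_self[of y] that by (simp add: exp_minus field_simps)
    moreover have "1 / (1 + y) \<le> (1 - y) + y\<^sup>2"
      using that by (simp add: field_simps power2_eq_square)
    ultimately show ?thesis by linarith
  qed
  have close: "norm (step_char (\<delta> n *\<^sub>R \<xi>) - \<psi> n) \<le> M * \<bar>\<delta> n\<bar> ^ 3 + a\<^sup>2 * \<bar>\<delta> n\<bar> ^ 4" for n
  proof -
    have "norm (step_char (\<delta> n *\<^sub>R \<xi>) - of_real (1 - a * (\<delta> n)\<^sup>2)) \<le> M * \<bar>\<delta> n\<bar> ^ 3"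
      using step_char_approx[of "\<delta> n *\<^sub>R \<xi>"]
      by (simp add: a_def M_def power_mult_distrib abs_mult sum_distrib_left sum_distrib_right mult_ac)
    moreover have "norm (of_real (1 - a * (\<delta> n)\<^sup>2) - \<psi> n) \<le> a\<^sup>2 * \<bar>\<delta> n\<bar> ^ 4"
      unfolding \<psi>_def of_real_diff[symmetric] norm_of_real
      using exp_approx[of "a * (\<delta> n)\<^sup>2"] a by (simp add: power_mult_distrib)
    ultimately show ?thesis by (intro norm_diff_triangle_le)
  qed
  have "(\<lambda>n. real n * (\<delta> n)\<^sup>2 * (M * \<bar>\<delta> n\<bar> + a\<^sup>2 * \<bar>\<delta> n\<bar>\<^sup>2)) \<longlonglongrightarrow> s * (M * 0 + a\<^sup>2 * 0\<^sup>2)"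
    by (intro tendsto_intros scaling \<delta>0)
  then have bound0: "(\<lambda>n. real n * (\<delta> n)\<^sup>2 * (M * \<bar>\<delta> n\<bar> + a\<^sup>2 * \<bar>\<delta> n\<bar>\<^sup>2)) \<longlonglongrightarrow> 0"
    by simp
  have "(\<lambda>n. step_char (\<delta> n *\<^sub>R \<xi>) ^ n - \<psi> n ^ n) \<longlonglongrightarrow> 0"
  proof (rule Lim_null_comparison[OF always_eventually bound0])
    show "\<forall>n. norm (step_char (\<delta> n *\<^sub>R \<xi>) ^ n - \<psi> n ^ n)
        \<le> real n * (\<delta> n)\<^sup>2 * (M * \<bar>\<delta> n\<bar> + a\<^sup>2 * \<bar>\<delta> n\<bar>\<^sup>2)"
    proof
      fix n
      have "norm (step_char (\<delta> n *\<^sub>R \<xi>) ^ n - \<psi> n ^ n) \<le> real n * norm (step_char (\<delta> n *\<^sub>R \<xi>) - \<psi> n)"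
        using a by (intro norm_power_diff norm_step_char_le_1) (simp add: \<psi>_def)
      also have "\<dots> \<le> real n * (M * \<bar>\<delta> n\<bar> ^ 3 + a\<^sup>2 * \<bar>\<delta> n\<bar> ^ 4)"
        by (intro mult_left_mono close) simp
      also have "\<dots> = real n * \<bar>\<delta> n\<bar>\<^sup>2 * (M * \<bar>\<delta> n\<bar> + a\<^sup>2 * \<bar>\<delta> n\<bar>\<^sup>2)"
        by (simp add: power2_eq_square power3_eq_cube power4_eq_xxxx algebra_simps)
      finally show "norm (step_char (\<delta> n *\<^sub>R \<xi>) ^ n - \<psi> n ^ n)
        \<le> real n * (\<delta> n)\<^sup>2 * (M * \<bar>\<delta> n\<bar> + a\<^sup>2 * \<bar>\<delta> n\<bar>\<^sup>2)" by simp
    qed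
  qed
  moreover have "(\<lambda>n. \<psi> n ^ n) \<longlonglongrightarrow> of_real (exp (- (a * s)))"
  proof -
    have "\<psi> n ^ n = of_real (exp (- (a * (real n * (\<delta> n)\<^sup>2))))" for n
      unfolding \<psi>_def of_real_power[symmetric] exp_of_nat_mult[symmetric] by (simp add: mult_ac)
    then show ?thesis
      by (simp only:) (intro tendsto_intros scaling)
  qed
  ultimately have "(\<lambda>n. step_char (\<delta> n *\<^sub>R \<xi>) ^ n) \<longlonglongrightarrow> of_real (exp (- (a * s)))"
    using tendsto_add by fastforce
  then show ?thesis
    by (simp add: a_def mult_ac)
qed

lemma walk_power_trig_poly_tendsto:
  fixes \<delta> :: "nat \<Rightarrow> real"
  assumes "trig_poly q" and scaling: "(\<lambda>n. real n * (\<delta> n)\<^sup>2) \<longlonglongrightarrow> s" and "0 < \<kappa> * s"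
    and start: "(\<lambda>n. \<delta> n *\<^sub>R X n) \<longlonglongrightarrow> x"
  shows "(\<lambda>n. (W ^^ n) (\<lambda>y. q (\<delta> n *\<^sub>R y)) (X n)) \<longlonglongrightarrow>
    (\<integral>z. gaussian_density (\<kappa> * s) x z * q z \<partial>lborel)"
  using assms(1)
proof induction
  case (wave c \<xi> \<theta>)
  have linear_Re: "linear (\<lambda>z. c * Re z)"
    by (rule linearI) (simp_all add: algebra_simps)
  have "(W ^^ n) (\<lambda>y. c * cos (\<xi> \<bullet> (\<delta> n *\<^sub>R y) + \<theta>)) (X n) =
      c * Re (step_char (\<delta> n *\<^sub>R \<xi>) ^ n * cis (\<xi> \<bullet> (\<delta> n *\<^sub>R X n) + \<theta>))" for n
    using walk_op_power_linear[OF linear_Re, of n S w "\<lambda>y. cis ((\<delta> n *\<^sub>R \<xi>) \<bullet> y + \<theta>)"]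
      walk_power_wave[of n "\<delta> n *\<^sub>R \<xi>" \<theta> "X n"]
    by simp
  moreover have "(\<lambda>n. c * Re (step_char (\<delta> n *\<^sub>R \<xi>) ^ n * cis (\<xi> \<bullet> (\<delta> n *\<^sub>R X n) + \<theta>))) \<longlonglongrightarrow>
      c * Re (of_real (exp (- (\<kappa> * s) * (norm \<xi>)\<^sup>2 / 2)) * cis (\<xi> \<bullet> x + \<theta>))"
    by (intro tendsto_intros step_char_power_tendsto scaling start)
  moreover have "(\<integral>z. gaussian_density (\<kappa> * s) x z * (c * cos (\<xi> \<bullet> z + \<theta>)) \<partial>lborel) =
      c * (\<integral>z. gaussian_density (\<kappa> * s) x z * cos (\<xi> \<bullet> z + \<theta>) \<partial>lborel)"
    by (subst integral_mult_right_zero[symmetric]) (simp only: mult_ac)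
  ultimately show ?case
    using integral_gaussian_wave[OF \<open>0 < \<kappa> * s\<close>, of x \<xi> \<theta>] by simp
next
  case (add f g)
  then show ?case
    using \<open>0 < \<kappa> * s\<close> by (simp add: walk_op_power_add distrib_left integrable_gaussian_trig_poly tendsto_add)
qed

text \<open>A central limit theorem for bounded continuous \<open>f\<close>. In the proof, \<open>m n\<close> and \<open>m'\<close> are the means
  of \<open>1 + (norm z)\<^sup>2\<close> under the rescaled walk and under the Gaussian. They bound the cost of
  replacing \<open>f\<close> by a trigonometric polynomial on either side.\<close>

theorem walk_power_tendsto_gaussian:
  fixes \<delta> :: "nat \<Rightarrow> real" and f :: "'a \<Rightarrow> real"
  assumes f: "continuous_on UNIV f" and K: "\<And>z. \<bar>f z\<bar> \<le> K"
    and scaling: "(\<lambda>n. real n * (\<delta> n)\<^sup>2) \<longlonglongrightarrow> s" and "0 < \<kappa> * s"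
    and start: "(\<lambda>n. \<delta> n *\<^sub>R X n) \<longlonglongrightarrow> x"
  shows "(\<lambda>n. (W ^^ n) (\<lambda>y. f (\<delta> n *\<^sub>R y)) (X n)) \<longlonglongrightarrow>
    (\<integral>z. gaussian_density (\<kappa> * s) x z * f z \<partial>lborel)"
proof -
  let ?G = "\<lambda>g. \<integral>z. gaussian_density (\<kappa> * s) x z * g z \<partial>lborel"
  let ?\<Lambda> = "\<lambda>g n. (W ^^ n) (\<lambda>y. g (\<delta> n *\<^sub>R y)) (X n)"
  define m where "m n = 1 + ((norm (\<delta> n *\<^sub>R X n))\<^sup>2 + real n * (\<delta> n)\<^sup>2 * (\<Sum>v\<in>S. w v * (norm v)\<^sup>2))" for n
  define m' where "m' = ?G (\<lambda>z. 1 + (norm z)\<^sup>2)"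
  have int_m': "integrable lborel (\<lambda>z. gaussian_density (\<kappa> * s) x z * (1 + (norm z)\<^sup>2))"
    using integrable_gaussian_density[of _ x] integrable_gaussian_second_moment[of _ x] \<open>0 < \<kappa> * s\<close>
    by (simp add: distrib_left)
  have int_f: "integrable lborel (\<lambda>z. gaussian_density (\<kappa> * s) x z * f z)"
    using \<open>0 < \<kappa> * s\<close> f K by (intro integrable_gaussian_bounded borel_measurable_continuous_onI)
  have "m \<longlonglongrightarrow> 1 + ((norm x)\<^sup>2 + s * (\<Sum>v\<in>S. w v * (norm v)\<^sup>2))"
    unfolding m_def by (intro tendsto_intros scaling start)
  then have "Bseq m"
    by (intro convergent_imp_Bseq convergentI)
  then obtain B where B: "0 < B" "\<And>n. norm (m n) \<le> B" by (auto simp: Bseq_def)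
  have m': "0 \<le> m'"
    unfolding m'_def by (intro integral_nonneg_AE) (simp add: gaussian_density_nonneg)
  show ?thesis
  proof (rule LIMSEQ_I)
    fix r :: real
    assume "0 < r"
    define \<epsilon> where "\<epsilon> = r / 2 / (B + m' + 1)"
    have "0 < \<epsilon>" using \<open>0 < r\<close> B(1) m' by (simp add: \<epsilon>_def)
    moreover have "\<epsilon> * (B + m' + 1) = r / 2"
      using B(1) m' by (intro nonzero_eq_divide_eq[THEN iffD1, OF _ \<epsilon>_def]) simp
    ultimately have \<epsilon>: "0 < \<epsilon>" "\<epsilon> * B + \<epsilon> * m' < r / 2"
      by (simp_all add: distrib_left)
    obtain q where q: "trig_poly q" "\<And>z. \<bar>f z - q z\<bar> \<le> \<epsilon> * (1 + (norm z)\<^sup>2)"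
      using trig_poly_approximation[OF f K \<epsilon>(1)] by metis
    have int_q: "integrable lborel (\<lambda>z. gaussian_density (\<kappa> * s) x z * q z)"
      using integrable_gaussian_trig_poly \<open>0 < \<kappa> * s\<close> q(1) .
    have walk_close: "\<bar>?\<Lambda> f n - ?\<Lambda> q n\<bar> \<le> \<epsilon> * B" for n
    proof -
      have "\<bar>?\<Lambda> f n - ?\<Lambda> q n\<bar> = norm ((W ^^ n) (\<lambda>y. f (\<delta> n *\<^sub>R y) - q (\<delta> n *\<^sub>R y)) (X n))"
        by (simp add: walk_op_power_diff)
      also have "\<dots> \<le> (W ^^ n) (\<lambda>y. \<epsilon> + \<epsilon> * (\<delta> n)\<^sup>2 * (norm y)\<^sup>2) (X n)"
      proof (rule walk_power_norm_le)
        show "norm (f (\<delta> n *\<^sub>R y) - q (\<delta> n *\<^sub>R y)) \<le> \<epsilon> + \<epsilon> * (\<delta> n)\<^sup>2 * (norm y)\<^sup>2" for y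
          using q(2)[of "\<delta> n *\<^sub>R y"] by (simp add: algebra_simps power_mult_distrib)
      qed
      also have "\<dots> = \<epsilon> * m n"
        unfolding walk_power_quadratic by (simp add: m_def algebra_simps power_mult_distrib)
      also have "\<dots> \<le> \<epsilon> * B"
        using B(2)[of n] \<epsilon>(1) by simp
      finally show ?thesis .
    qed
    have heat_close: "\<bar>?G q - ?G f\<bar> \<le> \<epsilon> * m'"
    proof -
      have "\<bar>?G q - ?G f\<bar> = norm (\<integral>z. gaussian_density (\<kappa> * s) x z * (f z - q z) \<partial>lborel)"
        using int_f int_q by (simp add: right_diff_distrib)
      also have "\<dots> \<le> (\<integral>z. \<epsilon> * (gaussian_density (\<kappa> * s) x z * (1 + (norm z)\<^sup>2)) \<partial>lborel)"
      proof (rule Bochner_Integration.integral_norm_bound_integral)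
        fix z
        show "norm (gaussian_density (\<kappa> * s) x z * (f z - q z))
            \<le> \<epsilon> * (gaussian_density (\<kappa> * s) x z * (1 + (norm z)\<^sup>2))"
          using mult_left_mono[OF q(2)[of z] gaussian_density_nonneg[of "\<kappa> * s" x z]]
          by (simp add: abs_mult gaussian_density_nonneg mult_ac)
      qed (use int_f int_q int_m' in \<open>auto simp: right_diff_distrib\<close>)
      also have "\<dots> = \<epsilon> * m'" by (simp add: m'_def)
      finally show ?thesis .
    qed
    have "?\<Lambda> q \<longlonglongrightarrow> ?G q"
      using walk_power_trig_poly_tendsto[OF q(1) scaling \<open>0 < \<kappa> * s\<close> start] .
    then obtain N where N: "\<And>n. n \<ge> N \<Longrightarrow> norm (?\<Lambda> q n - ?G q) < r / 2"
      using LIMSEQ_D[of "?\<Lambda> q" "?G q" "r / 2"] \<open>0 < r\<close> by auto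
    have "norm (?\<Lambda> f n - ?G f) < r" if "n \<ge> N" for n
    proof -
      have "\<bar>?\<Lambda> q n - ?G q\<bar> < r / 2" using N[OF that] by simp
      with walk_close[of n] heat_close \<epsilon>(2) show ?thesis
        unfolding real_norm_def by linarith
    qed
    then show "\<exists>N. \<forall>n\<ge>N. norm (?\<Lambda> f n - ?G f) < r" by blast
  qed
qed

end

section \<open>The triangular lattice in its standard realization\<close>

definition tri_steps :: "real^2 \<Rightarrow> real^2 \<Rightarrow> (real^2) set" where
  "tri_steps e1 e2 = {e1, - e1, e2, - e2, e2 - e1, - (e2 - e1)}"

lemma tri_V_zero: "0 \<in> tri_V e1 e2"
  unfolding tri_V_def by (rule CollectI, rule exI[of _ 0], rule exI[of _ 0]) simp

lemma tri_V_add: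
  assumes "x \<in> tri_V e1 e2" "y \<in> tri_V e1 e2"
  shows "x + y \<in> tri_V e1 e2"
proof -
  from assms obtain a b a' b' where
    "x = of_int a *\<^sub>R e1 + of_int b *\<^sub>R e2" "y = of_int a' *\<^sub>R e1 + of_int b' *\<^sub>R e2"
    unfolding tri_V_def by blast
  then have "x + y = of_int (a + a') *\<^sub>R e1 + of_int (b + b') *\<^sub>R e2"
    by (simp add: algebra_simps)
  then show ?thesis unfolding tri_V_def by blast
qed

lemma tri_steps_subset_V: "tri_steps e1 e2 \<subseteq> tri_V e1 e2"
proof -
  have V: "of_int a *\<^sub>R e1 + of_int b *\<^sub>R e2 \<in> tri_V e1 e2" for a b
    unfolding tri_V_def by blast
  show ?thesis
    using V[of 1 0] V[of "-1" 0] V[of 0 1] V[of 0 "-1"] V[of "-1" 1] V[of 1 "-1"]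
    by (simp add: tri_steps_def)
qed

lemma tri_E_from_eq:
  assumes "x \<in> tri_V e1 e2"
  shows "tri_E_from e1 e2 x = (\<lambda>v. (x, x + v)) ` tri_steps e1 e2"
proof -
  have "x - y \<in> tri_steps e1 e2 \<longleftrightarrow> y - x \<in> tri_steps e1 e2" for y
    using minus_diff_eq[of x y] minus_diff_eq[of y x] unfolding tri_steps_def
    by (smt (verit, best) insert_iff empty_iff minus_minus)
  then have "tri_E_from e1 e2 x = {(x, y) | y. y \<in> tri_V e1 e2 \<and> y - x \<in> tri_steps e1 e2}"
    using assms unfolding tri_E_from_def tri_E_def tri_steps_def[symmetric] by auto
  also have "\<dots> = (\<lambda>v. (x, x + v)) ` tri_steps e1 e2"
  proof -
    have "x + v \<in> tri_V e1 e2" if "v \<in> tri_steps e1 e2" for v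
      using tri_V_add[OF assms] tri_steps_subset_V that by blast
    then show ?thesis
      by (auto simp: image_iff intro!: bexI[where x = "_ - x"])
  qed
  finally show ?thesis .
qed

context triangular_walk
begin

abbreviation step_weight :: "real^2 \<Rightarrow> real" where
  "step_weight v \<equiv> p (0, v)"

lemma tri_step_cases:
  assumes "v \<in> tri_steps e1 e2"
  obtains "v = e1" | "v = - e1" | "v = e2" | "v = - e2" | "v = e2 - e1" | "v = - (e2 - e1)"
  using assms unfolding tri_steps_def by blast

lemma translation_invariant:
  assumes "x \<in> tri_V e1 e2" "v \<in> tri_steps e1 e2"
  shows "p (x, x + v) = step_weight v"
  using assms(2)
proof (cases rule: tri_step_cases)
  case 1
  then show ?thesis using p_e1[OF assms(1)] p_e1[OF tri_V_zero] by simp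
next
  case 2
  then show ?thesis using p_minus_e1[OF assms(1)] p_minus_e1[OF tri_V_zero] by simp
next
  case 3
  then show ?thesis using p_e2[OF assms(1)] p_e2[OF tri_V_zero] by simp
next
  case 4
  then show ?thesis using p_minus_e2[OF assms(1)] p_minus_e2[OF tri_V_zero] by simp
next
  case 5
  then show ?thesis using p_e3[OF assms(1)] p_e3[OF tri_V_zero] by simp
next
  case 6
  then show ?thesis using p_minus_e3[OF assms(1)] p_minus_e3[OF tri_V_zero]
    by (simp only: 6 diff_conv_add_uminus[of _ "e2 - e1"] add_0)
qed

lemma sum_edges_from:
  assumes "x \<in> tri_V e1 e2"
  shows "(\<Sum>e\<in>tri_E_from e1 e2 x. p e *\<^sub>R g e) =
    (\<Sum>v\<in>tri_steps e1 e2. step_weight v *\<^sub>R g (x, x + v))"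
  unfolding tri_E_from_eq[OF assms]
  by (subst sum.reindex) (auto simp: inj_on_def translation_invariant[OF assms])

text \<open>The lattice is invariant under the steps, so that iterating the transition operator from a
  vertex never leaves it.\<close>

lemma trans_op_power_eq_walk_op_power:
  assumes "x \<in> tri_V e1 e2"
  shows "(trans_op e1 e2 p ^^ n) u x = (walk_op (tri_steps e1 e2) step_weight ^^ n) u x"
  using assms
proof (induction n arbitrary: x)
  case (Suc n)
  have "(trans_op e1 e2 p ^^ Suc n) u x =
      (\<Sum>v\<in>tri_steps e1 e2. step_weight v * (trans_op e1 e2 p ^^ n) u (x + v))"
    using sum_edges_from[OF Suc.prems, of "\<lambda>e. (trans_op e1 e2 p ^^ n) u (snd e)"]
    by (simp add: trans_op_def[of _ _ _ "(trans_op e1 e2 p ^^ n) u"])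
  also have "\<dots> = (\<Sum>v\<in>tri_steps e1 e2.
      step_weight v * (walk_op (tri_steps e1 e2) step_weight ^^ n) u (x + v))"
    using tri_steps_subset_V[of e1 e2] tri_V_add[OF Suc.prems]
    by (intro sum.cong refl arg_cong2[where f = "(*)"] Suc.IH) auto
  finally show ?case
    by (simp add: walk_op_def[of _ _ "(walk_op _ _ ^^ n) u"])
qed simp

text \<open>A coincidence between two of the steps would be a nontrivial linear relation between \<open>e1\<close> and
  \<open>e2\<close>. Distinctness is what makes the weights of the six steps simply add up.\<close>

lemma steps_distinct: "distinct [e1, - e1, e2, - e2, e2 - e1, - (e2 - e1)]"
proof -
  have zero: "a = 0 \<and> b = 0" if "a *\<^sub>R e1 + b *\<^sub>R e2 = 0" for a b
  proof -
    have "e1 \<noteq> e2" "independent {e1, e2}" by (rule lin_indep)+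
    then show ?thesis
      using that unfolding independent_explicit
      by (auto dest!: spec[of _ "\<lambda>v. if v = e1 then a else b"])
  qed
  show ?thesis
    using zero[of 2 0] zero[of 1 "-1"] zero[of 1 1] zero[of 2 "-1"] zero[of 0 1] zero[of 1 0] zero[of 0 2]
      zero[of 1 "-2"] zero[of 2 "-2"]
    by (auto simp: algebra_simps scaleR_2 eq_neg_iff_add_eq_0)
qed

lemma sum_steps:
  "(\<Sum>v\<in>tri_steps e1 e2. step_weight v * g v) =
    \<alpha> * g e1 + \<alpha>' * g (- e1) + \<beta>' * g e2 + \<beta> * g (- e2) + \<gamma> * g (e2 - e1) + \<gamma>' * g (- (e2 - e1))"
proof -
  have "tri_steps e1 e2 = set [e1, - e1, e2, - e2, e2 - e1, - (e2 - e1)]"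
    by (simp add: tri_steps_def)
  then have "(\<Sum>v\<in>tri_steps e1 e2. step_weight v * g v) =
      (\<Sum>v\<leftarrow>[e1, - e1, e2, - e2, e2 - e1, - (e2 - e1)]. step_weight v * g v)"
    using steps_distinct by (simp only: sum_list_distinct_conv_sum_set)
  then show ?thesis
    using p_e1[OF tri_V_zero] p_minus_e1[OF tri_V_zero] p_e2[OF tri_V_zero]
      p_minus_e2[OF tri_V_zero] p_e3[OF tri_V_zero] p_minus_e3[OF tri_V_zero]
    by simp
qed

text \<open>With \<open>e1 = (l, 0)\<close> and \<open>e2 = (a, b)\<close>, a step has the covariance form
  \<open>A (\<xi> \<bullet> e1)\<^sup>2 + B (\<xi> \<bullet> e2)\<^sup>2 + C (\<xi> \<bullet> (e2 - e1))\<^sup>2\<close>, where opposite steps have been merged. The ratio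
  \<open>a / l = C / (B + C)\<close> makes the mixed coefficient vanish. The values of \<open>b\<close> and \<open>l\<close> then make the
  two pure coefficients equal to \<open>1 / 3\<close>.\<close>

lemma isotropic_walk_standard:
  assumes e1: "e1 = std_h1 (\<alpha> + \<alpha>') (\<beta> + \<beta>') (\<gamma> + \<gamma>')"
    and e2: "e2 = std_h2 (\<alpha> + \<alpha>') (\<beta> + \<beta>') (\<gamma> + \<gamma>')"
  shows "isotropic_walk (tri_steps e1 e2) step_weight (1 / 3)"
proof
  show "0 \<le> step_weight v" if "v \<in> tri_steps e1 e2" for v
  proof (rule p_nonneg)
    have "(0, v) \<in> tri_E_from e1 e2 0"
      using that by (simp add: tri_E_from_eq tri_V_zero)
    then show "(0, v) \<in> tri_E e1 e2" by (simp add: tri_E_from_def)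
  qed
  show "(\<Sum>v\<in>tri_steps e1 e2. step_weight v) = 1"
    using sum_steps[of "\<lambda>_. 1"] weights_sum by simp
  show "(\<Sum>v\<in>tri_steps e1 e2. step_weight v *\<^sub>R v) = 0"
    using zero_mean sum_edges_from[OF tri_V_zero, of "\<lambda>e. snd e - fst e"] by simp
  fix \<xi> :: "real^2"
  define A where "A = \<alpha> + \<alpha>'"
  define B where "B = \<beta> + \<beta>'"
  define C where "C = \<gamma> + \<gamma>'"
  define l where "l = std_l A B C"
  define a where "a = C / (B + C) * l"
  define b where "b = sqrt (Gamma_w A B C) / (B + C) * l"
  have nonneg: "0 \<le> A" "0 \<le> B" "0 \<le> C" using weights_nonneg by (simp_all add: A_def B_def C_def)
  have \<Gamma>: "0 < Gamma_w A B C" using Gamma_pos by (simp add: A_def B_def C_def)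
  have BC: "0 < B + C"
    using nonneg \<Gamma> by (cases "B = 0"; cases "C = 0") (auto simp: Gamma_w_def)
  have l: "l\<^sup>2 = (B + C) / (3 * Gamma_w A B C)"
    using BC \<Gamma> by (simp add: l_def std_l_def)
  have b2: "b\<^sup>2 = Gamma_w A B C / (B + C)\<^sup>2 * l\<^sup>2"
    using \<Gamma> by (simp add: b_def power_mult_distrib power_divide)
  have yy: "(B + C) * b\<^sup>2 = 1 / 3"
  proof -
    have "(B + C) * b\<^sup>2 = Gamma_w A B C / (B + C) * l\<^sup>2"
      unfolding b2 using BC by (simp add: power2_eq_square)
    then show ?thesis using BC \<Gamma> by (simp add: l)
  qed
  have al: "a - l = - (B / (B + C)) * l"
    using BC by (simp add: a_def field_simps)
  have xy: "B * a + C * (a - l) = 0"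
    unfolding al by (simp add: a_def)
  have xx: "A * l\<^sup>2 + B * a\<^sup>2 + C * (a - l)\<^sup>2 = 1 / 3"
  proof -
    have "A * l\<^sup>2 + B * a\<^sup>2 + C * (a - l)\<^sup>2 = (A + B * (C / (B + C))\<^sup>2 + C * (B / (B + C))\<^sup>2) * l\<^sup>2"
      unfolding al by (simp add: a_def power_mult_distrib power_divide algebra_simps)
    also have "A + B * (C / (B + C))\<^sup>2 + C * (B / (B + C))\<^sup>2 = Gamma_w A B C / (B + C)"
    proof -
      have "B * (C / (B + C))\<^sup>2 + C * (B / (B + C))\<^sup>2 = B * C * (B + C) / (B + C)\<^sup>2"
        by (simp add: power_divide power2_eq_square algebra_simps add_divide_distrib)
      also have "\<dots> = B * C / (B + C)" using BC by (simp add: power2_eq_square)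
      finally show ?thesis using BC by (simp add: Gamma_w_def field_simps)
    qed
    finally show ?thesis using BC \<Gamma> by (simp add: l)
  qed
  have e1': "e1 = vector [l, 0]" and e2': "e2 = vector [a, b]"
    by (simp_all add: e1 e2 std_h1_def std_h2_def A_def B_def C_def l_def a_def b_def)
  have "(\<Sum>v\<in>tri_steps e1 e2. step_weight v * (\<xi> \<bullet> v)\<^sup>2) =
      A * (\<xi> \<bullet> e1)\<^sup>2 + B * (\<xi> \<bullet> e2)\<^sup>2 + C * (\<xi> \<bullet> e2 - \<xi> \<bullet> e1)\<^sup>2"
    unfolding sum_steps
    by (simp add: inner_diff_right A_def B_def C_def algebra_simps power2_commute)
  also have "\<dots> = A * (\<xi>$1 * l)\<^sup>2 + B * (\<xi>$1 * a + \<xi>$2 * b)\<^sup>2 + C * (\<xi>$1 * a + \<xi>$2 * b - \<xi>$1 * l)\<^sup>2"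
    by (simp add: e1' e2' inner_vec_def sum_2)
  also have "\<dots> = (\<xi>$1)\<^sup>2 * (A * l\<^sup>2 + B * a\<^sup>2 + C * (a - l)\<^sup>2)
      + 2 * \<xi>$1 * \<xi>$2 * b * (B * a + C * (a - l)) + (\<xi>$2)\<^sup>2 * ((B + C) * b\<^sup>2)"
    by algebra
  also have "\<dots> = 1 / 3 * (norm \<xi>)\<^sup>2"
    unfolding xx xy yy power2_norm_eq_inner
    by (simp add: inner_vec_def sum_2 power2_eq_square)
  finally show "(\<Sum>v\<in>tri_steps e1 e2. step_weight v * (\<xi> \<bullet> v)\<^sup>2) = 1 / 3 * (norm \<xi>)\<^sup>2" .
qed

end

theorem theorem2p4:
  fixes e1 e2 x :: "real^2"
    and p :: "(real^2) \<times> (real^2) \<Rightarrow> real"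
    and \<alpha> \<alpha>' \<beta> \<beta>' \<gamma> \<gamma>' t :: real
    and \<delta> :: "nat \<Rightarrow> real"
    and f :: "real^2 \<Rightarrow> real"
    and X :: "nat \<Rightarrow> real^2"
  assumes "triangular_walk e1 e2 p \<alpha> \<alpha>' \<beta> \<beta>' \<gamma> \<gamma>'"
    and "e1 = std_h1 (\<alpha> + \<alpha>') (\<beta> + \<beta>') (\<gamma> + \<gamma>')"
    and "e2 = std_h2 (\<alpha> + \<alpha>') (\<beta> + \<beta>') (\<gamma> + \<gamma>')"
    and "0 < t"
    and "\<And>n. 1 \<le> n \<Longrightarrow> 0 < \<delta> n"
    and "(\<lambda>n. real n * (\<delta> n)\<^sup>2) \<longlonglongrightarrow> 3 * t"
    and "continuous_on UNIV f"
    and "compact (closure {z. f z \<noteq> 0})"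
    and "\<And>n. 1 \<le> n \<Longrightarrow> X n \<in> tri_V e1 e2"
    and "(\<lambda>n. \<delta> n *\<^sub>R X n) \<longlonglongrightarrow> x"
  shows "(\<lambda>n. (trans_op e1 e2 p ^^ n) (\<lambda>y. f (\<delta> n *\<^sub>R y)) (X n)) \<longlonglongrightarrow> heat_op t f x"
proof -
  interpret triangular_walk e1 e2 p \<alpha> \<alpha>' \<beta> \<beta>' \<gamma> \<gamma>' by fact
  interpret walk: isotropic_walk "tri_steps e1 e2" step_weight "1 / 3"
    using assms(2,3) by (rule isotropic_walk_standard)
  let ?K = "closure {z. f z \<noteq> 0}"
  have "bounded (f ` ?K)"
    using assms(7,8)
    by (intro compact_imp_bounded compact_continuous_image) (auto intro: continuous_on_subset)
  then obtain K where K: "0 < K" "\<And>z. z \<in> ?K \<Longrightarrow> \<bar>f z\<bar> \<le> K"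
    unfolding bounded_pos by auto
  have "\<bar>f z\<bar> \<le> K" for z
    using K closure_subset[of "{z. f z \<noteq> 0}"] by (cases "f z = 0") auto
  with assms(4,6,7,10) have
    "(\<lambda>n. (walk_op (tri_steps e1 e2) step_weight ^^ n) (\<lambda>y. f (\<delta> n *\<^sub>R y)) (X n)) \<longlonglongrightarrow>
      (\<integral>z. gaussian_density (1 / 3 * (3 * t)) x z * f z \<partial>lborel)"
    by (intro walk.walk_power_tendsto_gaussian) auto
  then have "(\<lambda>n. (walk_op (tri_steps e1 e2) step_weight ^^ n) (\<lambda>y. f (\<delta> n *\<^sub>R y)) (X n)) \<longlonglongrightarrow>
      heat_op t f x"
    using \<open>0 < t\<close> by (simp add: heat_op_eq_gaussian_integral)
  moreover have "\<forall>\<^sub>F n in sequentially.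
      (walk_op (tri_steps e1 e2) step_weight ^^ n) (\<lambda>y. f (\<delta> n *\<^sub>R y)) (X n) =
      (trans_op e1 e2 p ^^ n) (\<lambda>y. f (\<delta> n *\<^sub>R y)) (X n)"
    using eventually_ge_at_top[of 1]
    by eventually_elim (simp add: trans_op_power_eq_walk_op_power assms(9))
  ultimately show ?thesis
    by (rule Lim_transform_eventually)
qed

end
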